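(* Let $n\ge 1$ and $k\ge 2$ be integers. The statistic $X$ on $\mathcal{P}_{n,k}$ is uniformly distributed over $0,1,2,\ldots,n-1$; that is, $X$ takes values in $\{0,1,\ldots,n-1\}$ and each of these values is taken by the same number of paths in $\mathcal{P}_{n,k}$.
   Context: $\mathcal{P}_{n,k}$ denotes the set of lattice paths (starting at a fixed point, say the origin) consisting of $n+1$ upsteps $U=(1,1)$ and $(k-1)n-1$ downsteps $D=(1,-1)$ in any order, so $|\mathcal{P}_{n,k}|=\binom{kn}{n+1}$. A path in $\mathcal{P}_{n,k}$ has $kn+1$ points (vertices), labeled $0,1,2,\ldots,kn$ from left to right; points $0$ and $kn$ are the initial and terminal points and the others are interior. The $k$-divisible points are those whose label is divisible by $k$. The baseline of a path is the line joining its initial and terminal points. For $P\in\mathcal{P}_{n,k}$, $X(P)$ is the number of interior $k$-divisible points of $P$ lying strictly above the baseline of $P$. *)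

theory Defs
  imports Complex_Main "HOL-Library.Product_Plus"
begin

datatype step = U | D

fun step_vector :: "step \<Rightarrow> int \<times> int" where
  "step_vector U = (1, 1)"
| "step_vector D = (1, -1)"

text \<open>A path starting at the origin is represented by its list of steps; its points are
  labeled \<open>0, \<dots>, length P\<close>.\<close>

definition point :: "step list \<Rightarrow> nat \<Rightarrow> int \<times> int" where
  "point P i = (\<Sum>s\<leftarrow>take i P. step_vector s)"

text \<open>The subtraction of natural numbers does not truncate for \<open>n \<ge> 1\<close> and \<open>k \<ge> 2\<close>.\<close>

definition paths :: "nat \<Rightarrow> nat \<Rightarrow> step list set" where
  "paths n k = {P. count_list P U = n + 1 \<and> count_list P D = (k - 1) * n - 1}"

definition baseline :: "step list \<Rightarrow> real \<Rightarrow> real" where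
  "baseline P x =
     (let (x0, y0) = point P 0; (x1, y1) = point P (length P)
      in real_of_int y0 + (x - real_of_int x0) * (real_of_int (y1 - y0) / real_of_int (x1 - x0)))"

definition strictly_above_baseline :: "step list \<Rightarrow> nat \<Rightarrow> bool" where
  "strictly_above_baseline P i \<longleftrightarrow>
     real_of_int (snd (point P i)) > baseline P (real_of_int (fst (point P i)))"

definition X :: "nat \<Rightarrow> step list \<Rightarrow> nat" where
  "X k P = card {i. 0 < i \<and> i < length P \<and> k dvd i \<and> strictly_above_baseline P i}"

end

theory Submission
  imports Defs
begin

text \<open>
  The proof is a cycle-lemma argument.  Cut a path of length \<open>kn\<close> into \<open>n\<close> blocks of \<open>k\<close> steps and
  consider the \<open>n\<close> rotations of the path that permute these blocks cyclically.  Up to a positive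
  factor, the height of a point above the baseline is its \<^emph>\<open>tilt\<close>, the integer obtained by shearing the
  path until its baseline is horizontal.  Since the tilt vanishes at both ends, it extends
  periodically, and rotating the path to start at point \<open>r\<close> merely shifts the labels by \<open>r\<close> and
  subtracts the tilt at \<open>r\<close> (\<open>tilt_rotate\<close>).  Hence the statistic of the rotated path is the number
  of \<open>k\<close>-divisible points whose tilt exceeds that of \<open>r\<close>, which is the rank of \<open>r\<close>
  (\<open>X_rotate\<close>).

  As \<open>n + 1\<close> and \<open>n\<close> are coprime, the \<open>n\<close> tilts in question are pairwise distinct
  (\<open>inj_on_tilt\<close>), so these ranks are \<open>0, \<dots>, n - 1\<close>, each occurring once
  (\<open>bij_betw_rank\<close>): every value is attained by exactly one of the \<open>n\<close> rotations of any given
  path.  Rotations permute the set of paths, so counting the pairs of a path and a rotation that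
  yields the value \<open>i\<close> in two ways shows that \<open>n\<close> times the number of paths with value \<open>i\<close> is the
  number of all paths, whatever \<open>i\<close> is.
\<close>

section \<open>Ranks in a finite set\<close>

lemma bij_betw_rank:
  fixes f :: "'a \<Rightarrow> 'b::linorder"
  assumes fin: "finite A" and inj: "inj_on f A"
  shows "bij_betw (\<lambda>r. card {m \<in> A. f r < f m}) A {..<card A}"
proof -
  let ?rank = "\<lambda>r. card {m \<in> A. f r < f m}"
  have mono: "?rank s < ?rank r" if "r \<in> A" "s \<in> A" "f r < f s" for r s
    by (rule psubset_card_mono) (use that fin in auto)
  have "inj_on ?rank A"
  proof (rule inj_onI)
    fix r s assume rs: "r \<in> A" "s \<in> A" "?rank r = ?rank s"
    then have "\<not> f r < f s" "\<not> f s < f r"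
      using mono[of r s] mono[of s r] by linarith+
    then show "r = s"
      using inj rs by (meson inj_onD linorder_less_linear)
  qed
  moreover have "?rank ` A \<subseteq> {..<card A}"
    by (auto intro!: psubset_card_mono fin)
  ultimately show ?thesis
    by (simp add: bij_betw_def card_image card_subset_eq)
qed

section \<open>The tilt of a path\<close>

text \<open>Twice the tilt, divided by \<open>length P\<close>, is the height above the baseline; scaling by the length
  keeps it an integer.\<close>

definition tilt :: "step list \<Rightarrow> nat \<Rightarrow> int" where
  "tilt P m = int (length P) * int (count_list (take m P) U) - int (count_list P U) * int m"

lemma point_eq:
  assumes "m \<le> length P"
  shows "point P m = (int m, 2 * int (count_list (take m P) U) - int m)"
proof -
  have "(\<Sum>s\<leftarrow>Q. step_vector s) = (int (length Q), 2 * int (count_list Q U) - int (length Q))" for Q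
  proof (induction Q)
    case Nil
    show ?case by (simp add: zero_prod_def)
  next
    case (Cons s Q)
    then show ?case by (cases s) auto
  qed
  then show ?thesis
    using assms by (simp add: point_def)
qed

lemma strictly_above_baseline_iff_tilt:
  assumes "m \<le> length P" and "P \<noteq> []"
  shows "strictly_above_baseline P m \<longleftrightarrow> 0 < tilt P m"
proof -
  let ?L = "real (length P)" and ?C = "real (count_list P U)" and ?u = "real (count_list (take m P) U)"
  have L: "?L > 0"
    using assms by simp
  have "strictly_above_baseline P m \<longleftrightarrow> real m * ((2 * ?C - ?L) / ?L) < 2 * ?u - real m"
    using assms by (simp add: strictly_above_baseline_def baseline_def point_eq)
  also have "\<dots> \<longleftrightarrow> 0 < ?L * ?u - ?C * real m"
    using L by (simp add: field_simps)
  also have "\<dots> \<longleftrightarrow> 0 < real_of_int (tilt P m)"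
    by (simp add: tilt_def)
  finally show ?thesis by simp
qed

lemma tilt_0 [simp]: "tilt P 0 = 0"
  by (simp add: tilt_def)

lemma count_list_rotate [simp]: "count_list (rotate r P) x = count_list P x"
  by (metis append_take_drop_id add.commute count_list_append rotate_drop_take)

lemma count_list_take_drop:
  "count_list (take m (drop r P)) x + count_list (take r P) x = count_list (take (r + m) P) x"
  by (simp add: take_add)

text \<open>
  When \<open>r + m\<close> runs past the end of the path, the label may be reduced because one full turn
  contributes \<open>length P * count_list P U - count_list P U * length P = 0\<close>.
\<close>

lemma tilt_rotate:
  assumes r: "r < length P" and m: "m < length P"
  shows "tilt (rotate r P) m = tilt P ((r + m) mod length P) - tilt P r"
proof -
  let ?u = "\<lambda>i. count_list (take i P) U"
  have rot: "rotate r P = drop r P @ take r P"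
    using r by (simp add: rotate_drop_take)
  show ?thesis
  proof (cases "r + m < length P")
    case True
    then have "take m (rotate r P) = take m (drop r P)"
      by (simp add: rot)
    then have ups: "int (count_list (take m (rotate r P)) U) = int (?u (r + m)) - int (?u r)"
      using count_list_take_drop[of m r P U] by simp
    show ?thesis
      using True by (simp add: tilt_def ups right_diff_distrib distrib_left)
  next
    case False
    define s where "s = r + m - length P"
    have s: "r + m = length P + s" "s < r" "(r + m) mod length P = s"
      using False r m by (auto simp: s_def mod_if)
    have "take m (rotate r P) = drop r P @ take s P"
    proof -
      have "m = length (drop r P) + s"
        using s(1) r by simp
      then show ?thesis
        using s(2) by (simp add: rot min_def)
    qed
    moreover have "count_list (drop r P) U + ?u r = count_list P U"
      by (metis add.commute append_take_drop_id count_list_append)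
    ultimately have ups: "int (count_list (take m (rotate r P)) U)
        = int (count_list P U) - int (?u r) + int (?u s)"
      by simp
    have "int m = int (length P) + int s - int r"
      using s by linarith
    then show ?thesis
      by (simp add: tilt_def s(3) ups right_diff_distrib distrib_left)
  qed
qed

section \<open>The statistic of a rotated path\<close>

definition divisible_points :: "nat \<Rightarrow> step list \<Rightarrow> nat set" where
  "divisible_points k P = {m. m < length P \<and> k dvd m}"

lemma finite_divisible_points [simp]: "finite (divisible_points k P)"
  by (simp add: divisible_points_def)

text \<open>The initial point may be included in the count, since its tilt is zero.\<close>

lemma X_eq_tilt: "X k P = card {m \<in> divisible_points k P. 0 < tilt P m}"
proof -
  have "{i. 0 < i \<and> i < length P \<and> k dvd i \<and> strictly_above_baseline P i}
      = {m \<in> divisible_points k P. 0 < tilt P m}"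
  proof (rule set_eqI)
    fix m
    have "strictly_above_baseline P m \<longleftrightarrow> 0 < tilt P m" if "m < length P"
      using that by (intro strictly_above_baseline_iff_tilt) auto
    moreover have "0 < m" if "0 < tilt P m"
      using that by (intro gr0I) auto
    ultimately show "m \<in> {i. 0 < i \<and> i < length P \<and> k dvd i \<and> strictly_above_baseline P i}
        \<longleftrightarrow> m \<in> {m \<in> divisible_points k P. 0 < tilt P m}"
      by (auto simp: divisible_points_def)
  qed
  then show ?thesis
    by (simp add: X_def)
qed

lemma X_rotate:
  assumes k: "k dvd length P" and r: "r \<in> divisible_points k P"
  shows "X k (rotate r P) = card {m \<in> divisible_points k P. tilt P r < tilt P m}"
proof -
  let ?L = "length P" and ?A = "divisible_points k P"
  let ?g = "\<lambda>i. (r + i) mod ?L"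
  have L: "r < ?L" and kr: "k dvd r"
    using r by (auto simp: divisible_points_def)
  have maps: "?g ` ?A \<subseteq> ?A"
  proof
    fix m assume "m \<in> ?g ` ?A"
    then obtain i where i: "k dvd i" "m = ?g i"
      by (auto simp: divisible_points_def)
    have "m < ?L"
      unfolding i by (rule mod_less_divisor) (use L in linarith)
    moreover have "k dvd m"
      using k kr i by (simp add: dvd_mod)
    ultimately show "m \<in> ?A"
      by (simp add: divisible_points_def)
  qed
  have inj: "inj_on ?g ?A"
  proof (rule inj_onI)
    fix i j assume ij: "i \<in> ?A" "j \<in> ?A" "?g i = ?g j"
    then show "i = j"
      using L by (auto simp: divisible_points_def mod_if split: if_splits)
  qed
  have onto: "?g ` ?A = ?A"
    by (rule endo_inj_surj[OF _ maps inj]) simp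
  have "X k (rotate r P) = card {i \<in> ?A. tilt P r < tilt P (?g i)}"
    using L by (auto simp: X_eq_tilt divisible_points_def tilt_rotate intro!: arg_cong[of _ _ card])
  also have "\<dots> = card (?g ` {i \<in> ?A. tilt P r < tilt P (?g i)})"
    by (rule card_image[symmetric], rule inj_on_subset[OF inj]) auto
  also have "?g ` {i \<in> ?A. tilt P r < tilt P (?g i)} = {m \<in> ?g ` ?A. tilt P r < tilt P m}"
    by auto
  finally show ?thesis
    by (simp only: onto)
qed

section \<open>Paths with \<open>n + 1\<close> upsteps\<close>

lemma length_eq_count: "length P = count_list P U + count_list P D"
proof (induction P)
  case (Cons s P)
  then show ?case by (cases s) auto
qed simp

lemma length_paths:
  assumes "n \<ge> 1" "k \<ge> 2" "P \<in> paths n k"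
  shows "length P = k * n"
proof -
  obtain l where "k = Suc (Suc l)"
    using assms(2) by (metis add_2_eq_Suc le_Suc_ex)
  then show ?thesis
    using assms length_eq_count[of P] by (simp add: paths_def)
qed

lemma finite_paths:
  assumes "n \<ge> 1" "k \<ge> 2"
  shows "finite (paths n k)"
proof (rule finite_subset)
  have "set P \<subseteq> {U, D}" for P
    using step.exhaust by auto
  then show "paths n k \<subseteq> {P. set P \<subseteq> {U, D} \<and> length P = k * n}"
    using length_paths[OF assms] by blast
qed (rule finite_lists_length_eq, simp)

lemma rotate_image_paths:
  assumes "n \<ge> 1" "k \<ge> 2"
  shows "rotate r ` paths n k = paths n k" and "inj_on (rotate r) (paths n k)"
proof -
  show inj: "inj_on (rotate r) (paths n k)"
    by (rule inj_on_subset[of _ UNIV]) (simp_all add: rotate_def inj_fn inj_rotate1)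
  show "rotate r ` paths n k = paths n k"
    by (rule endo_inj_surj[OF finite_paths[OF assms] _ inj]) (auto simp: paths_def)
qed

lemma divisible_points_eq:
  assumes "k > 0" "length P = k * n"
  shows "divisible_points k P = (*) k ` {..<n}"
  using assms by (auto simp: divisible_points_def)

lemma card_divisible_points:
  assumes "k > 0" "length P = k * n"
  shows "card (divisible_points k P) = n"
  using assms by (simp add: divisible_points_eq card_image inj_on_def)

text \<open>Equal tilts at \<open>kp\<close> and \<open>kq\<close> make \<open>(n + 1) (p - q)\<close> a multiple of \<open>n\<close>.\<close>

lemma inj_on_tilt:
  assumes k: "k > 0" and len: "length P = k * n" and ups: "count_list P U = n + 1"
  shows "inj_on (tilt P) (divisible_points k P)"
proof -
  have "p = q" if pq: "p < n" "q < n" and eq: "tilt P (k * p) = tilt P (k * q)" for p q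
  proof -
    let ?u = "\<lambda>i. int (count_list (take (k * i) P) U)"
    have "int k * (int n * ?u p - (int n + 1) * int p) = int k * (int n * ?u q - (int n + 1) * int q)"
      using eq by (simp add: tilt_def len ups algebra_simps)
    then have "int n * ?u p - (int n + 1) * int p = int n * ?u q - (int n + 1) * int q"
      using k by simp
    then have "int p - int q = int n * (?u p - ?u q - int p + int q)"
      by (simp add: algebra_simps)
    then have "int n dvd int p - int q"
      by (rule dvdI)
    then have "int p mod int n = int q mod int n"
      by (simp add: mod_eq_dvd_iff)
    with pq show "p = q" by simp
  qed
  then show ?thesis
    using k len by (auto simp: divisible_points_eq inj_on_def)
qed

text \<open>
  The block rotations of \<open>P\<close> correspond to the \<open>k\<close>-divisible points at which they start, and the
  ranks of these points are all different.
\<close>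

lemma card_rotations_with_X:
  assumes "n \<ge> 1" "k \<ge> 2" and P: "P \<in> paths n k" and i: "i < n"
  shows "card {p \<in> {..<n}. X k (rotate (k * p) P) = i} = 1"
proof -
  let ?A = "divisible_points k P"
  let ?rank = "\<lambda>r. card {m \<in> ?A. tilt P r < tilt P m}"
  have k: "k > 0" and len: "length P = k * n" and ups: "count_list P U = n + 1"
    using assms length_paths by (auto simp: paths_def)
  have "bij_betw ((*) k) {..<n} ?A"
    using k len by (auto simp: divisible_points_eq bij_betw_def inj_on_def)
  moreover have "bij_betw ?rank ?A {..<n}"
    using bij_betw_rank[OF _ inj_on_tilt[OF k len ups]] by (simp add: card_divisible_points[OF k len])
  ultimately have bij: "bij_betw (?rank \<circ> (*) k) {..<n} {..<n}"
    by (rule bij_betw_trans)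
  have X_rank: "X k (rotate (k * p) P) = (?rank \<circ> (*) k) p" if "p \<in> {..<n}" for p
    using that k by (simp add: X_rotate len divisible_points_def)
  have "bij_betw (\<lambda>p. X k (rotate (k * p) P)) {..<n} {..<n}
      \<longleftrightarrow> bij_betw (?rank \<circ> (*) k) {..<n} {..<n}"
    by (rule bij_betw_cong) (rule X_rank)
  with bij have "bij_betw (\<lambda>p. X k (rotate (k * p) P)) {..<n} {..<n}"
    by (rule rev_iffD2)
  then have inj: "inj_on (\<lambda>p. X k (rotate (k * p) P)) {..<n}"
    and onto: "(\<lambda>p. X k (rotate (k * p) P)) ` {..<n} = {..<n}"
    by (simp_all add: bij_betw_def)
  from i onto obtain p where p: "p \<in> {..<n}" "X k (rotate (k * p) P) = i"
    by (metis (no_types, lifting) imageE lessThan_iff)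
  have "{q \<in> {..<n}. X k (rotate (k * q) P) = i} = {p}"
    using p by (auto dest: inj_onD[OF inj])
  then show ?thesis
    by simp
qed

text \<open>
  Count the pairs of a path and a block rotation that gives it the value \<open>i\<close>: each path occurs in
  exactly one pair, while each of the \<open>n\<close> rotations occurs once for every path with value \<open>i\<close>.
\<close>

lemma card_paths_with_X:
  assumes n: "n \<ge> 1" and k: "k \<ge> 2" and i: "i < n"
  shows "n * card {P \<in> paths n k. X k P = i} = card (paths n k)"
proof -
  have rot: "card {P \<in> paths n k. X k (rotate r P) = i} = card {P \<in> paths n k. X k P = i}" for r
  proof -
    have "{P \<in> paths n k. X k P = i} = {P \<in> rotate r ` paths n k. X k P = i}"
      by (simp only: rotate_image_paths(1)[OF n k])
    also have "\<dots> = rotate r ` {P \<in> paths n k. X k (rotate r P) = i}"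
      by auto
    finally have "card {P \<in> paths n k. X k P = i}
        = card (rotate r ` {P \<in> paths n k. X k (rotate r P) = i})"
      by simp
    also have "\<dots> = card {P \<in> paths n k. X k (rotate r P) = i}"
      by (rule card_image, rule inj_on_subset[OF rotate_image_paths(2)[OF n k]]) auto
    finally show ?thesis by simp
  qed
  have "(\<Sum>p<n. card {P \<in> paths n k. X k (rotate (k * p) P) = i}) = 1 * card (paths n k)"
    by (rule sum_multicount)
       (use card_rotations_with_X[OF n k] i finite_paths[OF n k] in auto)
  then show ?thesis
    by (simp add: rot)
qed

lemma X_less:
  assumes n: "n \<ge> 1" and k: "k \<ge> 2" and P: "P \<in> paths n k"
  shows "X k P < n"
proof -
  have len: "length P = k * n"
    using length_paths[OF assms] .
  have "0 \<in> divisible_points k P"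
    using n k len by (simp add: divisible_points_def)
  moreover have "0 \<notin> {m \<in> divisible_points k P. 0 < tilt P m}"
    by simp
  ultimately have "{m \<in> divisible_points k P. 0 < tilt P m} \<subset> divisible_points k P"
    by blast
  then have "X k P < card (divisible_points k P)"
    unfolding X_eq_tilt by (intro psubset_card_mono) simp_all
  then show ?thesis
    using k len by (simp add: card_divisible_points)
qed

theorem mainTheorem2:
  fixes n k :: nat
  assumes "n \<ge> 1" and "k \<ge> 2"
  shows "X k ` paths n k \<subseteq> {0..<n} \<and>
    (\<forall>i \<in> {0..<n}. \<forall>j \<in> {0..<n}.
       card {P \<in> paths n k. X k P = i} = card {P \<in> paths n k. X k P = j})"
proof (intro conjI ballI)
  show "X k ` paths n k \<subseteq> {0..<n}"
    using X_less[OF assms] by auto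
next
  fix i j assume "i \<in> {0..<n}" "j \<in> {0..<n}"
  then have "n * card {P \<in> paths n k. X k P = i} = n * card {P \<in> paths n k. X k P = j}"
    using card_paths_with_X[OF assms] by simp
  then show "card {P \<in> paths n k. X k P = i} = card {P \<in> paths n k. X k P = j}"
    using assms by simp
qed

end
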